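(* Every finitely measurable relation algebra is atomic.
   Context: A relation algebra is an algebra $\mathfrak A=(A,+,-,;,{}^{\smile},1')$ such that $(A,+,-)$ is a Boolean algebra and for all $r,s,t$: $r;(s;t)=(r;s);t$, $r;1'=r$, $r^{\smile\smile}=r$, $(r;s)^\smile=s^\smile;r^\smile$, $(r+s);t=r;t+s;t$, $(r+s)^\smile=r^\smile+s^\smile$, $r^\smile;-(r;s)+-s=-s$. Order, $0$, $1$, suprema, atoms refer to the Boolean part; $\mathfrak A$ is atomic if every nonzero element is above an atom. A function is an element $f$ with $f^\smile;f\le 1'$. A subidentity atom is an atom $x\le 1'$; it is measurable if $x;1;x$ is the sum (supremum) of a set of functions, and finitely measurable if $x;1;x$ is the sum of finitely many functions. A relation algebra is finitely measurable if $1'$ is the sum of a set of finitely measurable atoms. *)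

theory Defs
  imports "HOL-Library.Lub_Glb"
begin

definition atom :: "'a::boolean_algebra \<Rightarrow> bool" where
  "atom x \<longleftrightarrow> x \<noteq> bot \<and> (\<forall>y. y \<le> x \<longrightarrow> y = bot \<or> y = x)"

definition atomic_algebra :: "'a::boolean_algebra itself \<Rightarrow> bool" where
  "atomic_algebra _ \<longleftrightarrow> (\<forall>a::'a. a \<noteq> bot \<longrightarrow> (\<exists>x. atom x \<and> x \<le> a))"

text \<open>
  The Boolean part is the type class of Boolean algebras: \<open>+\<close>, \<open>-\<close>, \<open>0\<close>, \<open>1\<close> are
  \<^const>\<open>sup\<close>, \<^const>\<open>uminus\<close>, \<^const>\<open>bot\<close>, \<^const>\<open>top\<close>. It need not be complete, so
  ``\<open>b\<close> is the sum of the set \<open>S\<close>'' is rendered as \<open>isLub UNIV S b\<close>: the least upper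
  bound exists and equals \<open>b\<close>. The degenerate algebra (\<open>0 = 1\<close>) is not excluded.
\<close>

locale relation_algebra =
  fixes comp :: "'a::boolean_algebra \<Rightarrow> 'a \<Rightarrow> 'a"  (infixl \<open>;;\<close> 75)
    and conv :: "'a \<Rightarrow> 'a"
    and ide :: "'a"
  assumes comp_assoc: "r ;; (s ;; t) = (r ;; s) ;; t"
    and comp_ide: "r ;; ide = r"
    and conv_conv: "conv (conv r) = r"
    and conv_comp: "conv (r ;; s) = conv s ;; conv r"
    and comp_sup: "sup r s ;; t = sup (r ;; t) (s ;; t)"
    and conv_sup: "conv (sup r s) = sup (conv r) (conv s)"
    and tarski: "sup (conv r ;; (- (r ;; s))) (- s) = - s"
begin

definition is_function :: "'a \<Rightarrow> bool" where
  "is_function f \<longleftrightarrow> conv f ;; f \<le> ide"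

definition subidentity_atom :: "'a \<Rightarrow> bool" where
  "subidentity_atom x \<longleftrightarrow> atom x \<and> x \<le> ide"

definition finitely_measurable_atom :: "'a \<Rightarrow> bool" where
  "finitely_measurable_atom x \<longleftrightarrow> subidentity_atom x \<and>
     (\<exists>F. finite F \<and> (\<forall>f\<in>F. is_function f) \<and> isLub UNIV F (x ;; top ;; x))"

definition finitely_measurable :: bool where
  "finitely_measurable \<longleftrightarrow>
     (\<exists>X. (\<forall>x\<in>X. finitely_measurable_atom x) \<and> isLub UNIV X ide)"

end

end

theory Submission
  imports Defs
begin

text \<open>
  Given a nonzero element, cut it down to a nonzero part \<open>b \<le> x;1;y\<close> with \<open>x\<close>, \<open>y\<close> measurable
  atoms, and write \<open>x;1;x\<close> as the sum of a finite set \<open>F\<close> of functions. The translates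
  \<open>f\<^sup>\<smile>;c\<close> (\<open>f \<in> F\<close>) of any nonzero \<open>c \<le> b\<close> cover \<open>b\<close>. Among the nonzero elements below \<open>b\<close>
  choose \<open>m\<close> meeting as few of its own translates as possible. If \<open>0 < c < m\<close>, then some
  translate \<open>f\<^sup>\<smile>;c\<close> meets \<open>d = m - c\<close>, and \<open>e = c \<cdot> (f;d)\<close> is nonzero with \<open>f\<^sup>\<smile>;e \<le> d\<close>, as \<open>f\<close>
  is a function. So \<open>e\<close> misses its translate by \<open>f\<close> while \<open>m\<close> does not, contradicting the choice
  of \<open>m\<close>. Hence \<open>m\<close> is an atom.
\<close>

text \<open>Each \<open>s\<close> lies below \<open>- v\<close>, hence so does the least upper
  bound. Disjointness thus passes to any sum that exists, without completeness.\<close>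

lemma isLub_disjoint:
  fixes u v :: "'a::boolean_algebra"
  assumes "isLub UNIV S u" and "\<And>s. s \<in> S \<Longrightarrow> inf s v = bot"
  shows "inf u v = bot"
proof -
  have "isUb UNIV S (- v)"
    using assms(2) by (auto intro!: isUbI setleI simp: inf_shunt)
  then show ?thesis
    using isLub_le_isUb[OF assms(1)] by (simp add: inf_shunt)
qed

lemma atom_le:
  assumes "atom x" and "inf x a \<noteq> bot"
  shows "x \<le> a"
  using assms by (metis atom_def inf.cobounded1 inf.cobounded2)

context relation_algebra
begin

section \<open>Order properties of converse and composition\<close>

lemma conv_mono: "r \<le> s \<Longrightarrow> conv r \<le> conv s"
  by (metis conv_sup sup.absorb_iff2 sup.cobounded1)

lemma conv_le_iff: "conv r \<le> conv s \<longleftrightarrow> r \<le> s"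
  by (metis conv_conv conv_mono)

lemma conv_bot: "conv bot = bot"
  by (metis bot.extremum bot.extremum_unique conv_conv conv_le_iff)

lemma conv_top: "conv top = top"
  by (metis top.extremum top.extremum_unique conv_conv conv_le_iff)

lemma conv_inf: "conv (inf r s) = inf (conv r) (conv s)"
proof (rule antisym)
  show "conv (inf r s) \<le> inf (conv r) (conv s)"
    by (simp add: conv_mono)
  have "conv (inf (conv r) (conv s)) \<le> inf r s"
    by (metis conv_conv conv_mono inf.cobounded1 inf.cobounded2 le_inf_iff)
  then show "inf (conv r) (conv s) \<le> conv (inf r s)"
    by (metis conv_conv conv_mono)
qed

lemma conv_disjoint_iff: "inf (conv r) (conv s) = bot \<longleftrightarrow> inf r s = bot"
  by (metis conv_bot conv_conv conv_inf)

lemma comp_mono: "r \<le> r' \<Longrightarrow> s \<le> s' \<Longrightarrow> r ;; s \<le> r' ;; s'"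
proof -
  have left: "p \<le> q \<Longrightarrow> p ;; t \<le> q ;; t" for p q t
    by (metis comp_sup sup.absorb_iff2 sup.cobounded1)
  assume "r \<le> r'" "s \<le> s'"
  have "conv s ;; conv r' \<le> conv s' ;; conv r'"
    using \<open>s \<le> s'\<close> by (intro left conv_mono)
  then have "r' ;; s \<le> r' ;; s'"
    by (metis conv_comp conv_le_iff)
  with left[OF \<open>r \<le> r'\<close>] show ?thesis
    by (rule order_trans)
qed

lemma comp_sup_right: "r ;; sup s t = sup (r ;; s) (r ;; t)"
  by (metis comp_sup conv_comp conv_conv conv_sup)

lemma conv_ide: "conv ide = ide"
  by (metis comp_ide conv_comp conv_conv)

lemma ide_comp: "ide ;; r = r"
  by (metis comp_ide conv_comp conv_conv conv_ide)

section \<open>Schroeder equivalences and the Dedekind law\<close>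

lemma schroeder_left: "inf (r ;; s) t = bot \<longleftrightarrow> inf (conv r ;; t) s = bot"
proof -
  have imp: "inf (conv p ;; v) u = bot" if "inf (p ;; u) v = bot" for p u v
  proof -
    have "v \<le> - (p ;; u)"
      using that by (simp add: inf_shunt inf.commute)
    then have "conv p ;; v \<le> conv p ;; - (p ;; u)"
      by (intro comp_mono) auto
    also have "\<dots> \<le> - u"
      using tarski by (metis sup.cobounded1)
    finally show ?thesis
      by (simp add: inf_shunt)
  qed
  show ?thesis
    \<comment> \<open>One direction is the axiom \<open>tarski\<close>; the other is the same
      implication with \<open>conv r\<close> for \<open>r\<close>.\<close>
    using imp[of r s t] imp[of "conv r" t s] by (auto simp: conv_conv)
qed

text \<open>Converse reverses the factors and so reduces this to
  \<open>schroeder_left\<close>.\<close>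

lemma schroeder_right: "inf (r ;; s) t = bot \<longleftrightarrow> inf r (t ;; conv s) = bot"
proof -
  have "inf (r ;; s) t = bot \<longleftrightarrow> inf (conv s ;; conv r) (conv t) = bot"
    by (metis conv_comp conv_disjoint_iff)
  also have "\<dots> \<longleftrightarrow> inf (s ;; conv t) (conv r) = bot"
    by (subst schroeder_left) (simp add: conv_conv)
  also have "\<dots> \<longleftrightarrow> inf (t ;; conv s) r = bot"
    by (metis conv_comp conv_conv conv_disjoint_iff)
  finally show ?thesis
    by (simp add: inf.commute)
qed

lemma dedekind: "inf (r ;; s) t \<le> r ;; inf s (conv r ;; t)"
proof -
  let ?p = "inf s (conv r ;; t)" and ?q = "inf s (- (conv r ;; t))"
  have "s = sup ?p ?q"
    by (metis inf_sup_distrib1 inf_top_right sup_compl_top)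
  then have split: "r ;; s = sup (r ;; ?p) (r ;; ?q)"
    by (metis comp_sup_right)
  \<comment> \<open>The part of \<open>s\<close> outside \<open>conv r ;; t\<close> contributes
    nothing to \<open>r ;; s\<close> that meets \<open>t\<close>.\<close>
  have "inf (r ;; ?q) t = bot"
    by (subst schroeder_left) (simp add: inf_left_commute)
  then have "inf (r ;; s) t = inf (r ;; ?p) t"
    by (simp add: split inf_sup_distrib2)
  then show ?thesis
    by simp
qed

lemma conv_subidentity:
  assumes "x \<le> ide"
  shows "conv x = x"
proof -
  have le: "z \<le> conv z" if "z \<le> ide" for z
  proof -
    have "z = inf (z ;; ide) z"
      by (simp add: comp_ide)
    also have "\<dots> \<le> z ;; inf ide (conv z ;; z)"
      by (rule dedekind)
    \<comment> \<open>Both unconverted copies of \<open>z\<close> are weakened to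
      \<open>ide\<close>, so that only \<open>conv z\<close> survives.\<close>
    also have "\<dots> \<le> ide ;; (conv z ;; ide)"
      using that by (intro comp_mono) (auto intro: le_infI2 comp_mono)
    finally show ?thesis
      by (simp add: comp_ide ide_comp)
  qed
  show ?thesis
    using le[OF assms] le[of "conv x"] assms
    by (metis antisym conv_conv conv_ide conv_mono)
qed

section \<open>Cutting a nonzero element down by summands of the identity\<close>

lemma isLub_ide_comp_nonzero:
  assumes "isLub UNIV X ide" and "a \<noteq> bot"
  obtains x where "x \<in> X" and "x ;; a \<noteq> bot"
proof -
  have "\<exists>x\<in>X. x ;; a \<noteq> bot"
  proof (rule ccontr)
    assume "\<not> ?thesis"
    \<comment> \<open>Schroeder turns \<open>x ;; a = bot\<close> into a disjointness, which passes
      to the sum \<open>ide\<close>.\<close>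
    then have "inf x (top ;; conv a) = bot" if "x \<in> X" for x
      using that schroeder_right[of x a top] by auto
    then have "inf ide (top ;; conv a) = bot"
      by (rule isLub_disjoint[OF assms(1)])
    with assms(2) show False
      using schroeder_right[of ide a top] by (simp add: ide_comp)
  qed
  with that show thesis
    by blast
qed

text \<open>The left cut is made twice, the second time on the converse, where it acts on the right
  side.\<close>

lemma isLub_ide_nonzero_part:
  assumes "isLub UNIV X ide" and "a \<noteq> bot"
  obtains x y where "x \<in> X" and "y \<in> X" and "x ;; a ;; y \<noteq> bot"
proof -
  obtain x where x: "x \<in> X" "x ;; a \<noteq> bot"
    using isLub_ide_comp_nonzero[OF assms] .
  then have "conv (x ;; a) \<noteq> bot"
    by (metis conv_bot conv_conv)
  then obtain y where y: "y \<in> X" "y ;; conv (x ;; a) \<noteq> bot"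
    using isLub_ide_comp_nonzero[OF assms(1)] by blast
  have "y \<le> ide"
    using assms(1) y(1) by (auto simp: isLub_def leastP_def isUb_def setle_def)
  then have "x ;; a ;; y = conv (y ;; conv (x ;; a))"
    by (simp add: conv_comp conv_conv conv_subidentity)
  with y(2) have "x ;; a ;; y \<noteq> bot"
    by (metis conv_bot conv_conv)
  with that x(1) y(1) show thesis
    by blast
qed

section \<open>Covering by translates of a nonzero element\<close>

lemma le_square_comp:
  assumes x: "x \<le> ide" and y: "subidentity_atom y"
    and c: "c \<noteq> bot" "c \<le> x ;; top ;; y" and d: "d \<le> x ;; top ;; y"
  shows "d \<le> x ;; top ;; x ;; c"
proof -
  have "inf (top ;; x ;; c) y \<noteq> bot"
  proof
    assume "inf (top ;; x ;; c) y = bot"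
    then have "inf (x ;; top ;; y) c = bot"
      by (subst (asm) schroeder_left) (simp add: conv_comp conv_top conv_subidentity[OF x])
    with c show False
      by (simp add: inf.absorb2)
  qed
  \<comment> \<open>Since \<open>y\<close> is an atom, meeting \<open>top ;; x ;; c\<close> means
    lying below it.\<close>
  then have "y \<le> top ;; x ;; c"
    unfolding inf.commute[of _ y] using y by (intro atom_le) (simp_all add: subidentity_atom_def)
  then have "x ;; top ;; y \<le> x ;; top ;; (top ;; x ;; c)"
    by (intro comp_mono) auto
  also have "\<dots> = x ;; (top ;; top) ;; x ;; c"
    by (simp add: comp_assoc)
  also have "\<dots> \<le> x ;; top ;; x ;; c"
    by (intro comp_mono) auto
  finally show ?thesis
    using d by (rule order_trans[rotated])
qed

lemma exists_translate_meeting: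
  assumes x: "x \<le> ide" and F: "isLub UNIV F (x ;; top ;; x)"
    and d: "d \<noteq> bot" "d \<le> x ;; top ;; x ;; c"
  obtains f where "f \<in> F" and "inf (conv f ;; c) d \<noteq> bot"
proof -
  have "\<exists>f\<in>F. inf (conv f ;; c) d \<noteq> bot"
  proof (rule ccontr)
    assume "\<not> ?thesis"
    then have "inf f (c ;; conv d) = bot" if "f \<in> F" for f
      using that schroeder_right[of "conv f" c d] conv_disjoint_iff[of "conv f" "d ;; conv c"]
      by (auto simp: conv_comp conv_conv)
    then have "inf (x ;; top ;; x) (c ;; conv d) = bot"
      by (rule isLub_disjoint[OF F])
    \<comment> \<open>Taking converses and using that \<open>x ;; top ;; x\<close> is symmetric
      brings the disjointness back to one between \<open>x ;; top ;; x ;; c\<close> and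
      \<open>d\<close>.\<close>
    then have "inf (conv (x ;; top ;; x)) (conv (c ;; conv d)) = bot"
      by (simp add: conv_disjoint_iff)
    moreover have "conv (x ;; top ;; x) = x ;; top ;; x"
      by (simp add: conv_comp conv_top conv_subidentity[OF x] comp_assoc)
    ultimately have "inf (x ;; top ;; x ;; c) d = bot"
      by (subst schroeder_right) (simp only: conv_comp conv_conv)
    with d show False
      by (simp add: inf.absorb2)
  qed
  with that show thesis
    by blast
qed

lemma atom_below:
  assumes x: "finitely_measurable_atom x" and y: "subidentity_atom y"
    and b: "b \<noteq> bot" "b \<le> x ;; top ;; y"
  shows "\<exists>m. atom m \<and> m \<le> b"
proof -
  obtain F where F: "finite F" "\<And>f. f \<in> F \<Longrightarrow> is_function f" "isLub UNIV F (x ;; top ;; x)"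
    and x_ide: "x \<le> ide"
    using x unfolding finitely_measurable_atom_def subidentity_atom_def by blast
  \<comment> \<open>\<open>S u\<close> indexes the translates of \<open>u\<close> that meet
    \<open>u\<close>; its size is the quantity to be minimised.\<close>
  define S where "S u = {f \<in> F. inf (conv f ;; u) u \<noteq> bot}" for u
  have finS: "finite (S u)" for u
    using F(1) by (simp add: S_def)
  obtain m where m: "m \<noteq> bot" "m \<le> b"
    and least: "\<And>u. u \<noteq> bot \<Longrightarrow> u \<le> b \<Longrightarrow> card (S m) \<le> card (S u)"
    using ex_has_least_nat[of "\<lambda>u. u \<noteq> bot \<and> u \<le> b" b "\<lambda>u. card (S u)"] b(1) by auto
  have "c = m" if c: "c \<le> m" "c \<noteq> bot" for c
  proof (rule ccontr)
    assume "c \<noteq> m"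
    define d where "d = inf m (- c)"
    have "d \<noteq> bot"
      using c(1) \<open>c \<noteq> m\<close> by (auto simp: d_def inf_shunt)
    have "d \<le> m" and dc: "inf d c = bot"
      by (auto simp: d_def inf_assoc)
    have "d \<le> x ;; top ;; x ;; c"
      using le_square_comp[OF x_ide y c(2)] c(1) \<open>d \<le> m\<close> m(2) b(2) by (meson order_trans)
    with \<open>d \<noteq> bot\<close> obtain f where f: "f \<in> F" "inf (conv f ;; c) d \<noteq> bot"
      using exists_translate_meeting[OF x_ide F(3)] by blast
    \<comment> \<open>The part of \<open>c\<close> whose translate by \<open>conv f\<close> reaches
      \<open>d\<close>; Schroeder makes it nonzero.\<close>
    define e where "e = inf (f ;; d) c"
    have "e \<noteq> bot"
      using f(2) schroeder_left[of "conv f" c d] by (simp add: e_def conv_conv)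
    have "e \<le> c"
      by (simp add: e_def)
    then have "e \<le> m"
      using c(1) by simp
    \<comment> \<open>Functionality of \<open>f\<close> keeps the whole translate of
      \<open>e\<close> inside \<open>d\<close>, away from \<open>c\<close> and so from
      \<open>e\<close>.\<close>
    have "conv f ;; e \<le> (conv f ;; f) ;; d"
      unfolding comp_assoc[symmetric] by (intro comp_mono) (auto simp: e_def)
    also have "\<dots> \<le> ide ;; d"
      using F(2)[OF f(1)] by (intro comp_mono) (auto simp: is_function_def)
    finally have fe: "conv f ;; e \<le> d"
      by (simp add: ide_comp)
    have "f \<notin> S e"
      using inf_mono[OF fe \<open>e \<le> c\<close>] dc by (simp add: S_def bot_unique)
    moreover have "f \<in> S m"
    proof -
      have "conv f ;; c \<le> conv f ;; m"
        using c(1) by (intro comp_mono) auto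
      then have "inf (conv f ;; c) d \<le> inf (conv f ;; m) m"
        using \<open>d \<le> m\<close> by (rule inf_mono)
      then have "inf (conv f ;; m) m \<noteq> bot"
        using f(2) le_bot by fastforce
      with f(1) show ?thesis
        by (simp add: S_def)
    qed
    moreover have "S e \<subseteq> S m"
    proof -
      have "inf (conv g ;; e) e \<le> inf (conv g ;; m) m" for g
        using \<open>e \<le> m\<close> by (intro inf_mono comp_mono) auto
      then have "inf (conv g ;; e) e = bot" if "inf (conv g ;; m) m = bot" for g
        using that le_bot by metis
      then show ?thesis
        by (auto simp only: S_def)
    qed
    ultimately have "S e \<subset> S m"
      by blast
    \<comment> \<open>Finiteness of \<open>F\<close> enters here: strict inclusion lowers the
      cardinality.\<close>
    then have "card (S e) < card (S m)"
      by (intro psubset_card_mono finS)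
    moreover have "card (S m) \<le> card (S e)"
      using least \<open>e \<noteq> bot\<close> \<open>e \<le> m\<close> m(2) by (meson order_trans)
    ultimately show False
      by simp
  qed
  then have "atom m"
    using m(1) by (auto simp: atom_def)
  with m(2) show ?thesis
    by blast
qed

lemma atomic_of_finitely_measurable:
  assumes finitely_measurable
  shows "atomic_algebra TYPE('a)"
  unfolding atomic_algebra_def
proof (intro allI impI)
  fix a :: 'a
  assume "a \<noteq> bot"
  obtain X where X: "\<And>x. x \<in> X \<Longrightarrow> finitely_measurable_atom x" "isLub UNIV X ide"
    using assms unfolding finitely_measurable_def by blast
  obtain x y where xy: "x \<in> X" "y \<in> X" "x ;; a ;; y \<noteq> bot"
    using isLub_ide_nonzero_part[OF X(2) \<open>a \<noteq> bot\<close>] .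
  have y: "subidentity_atom y" and "x \<le> ide" "y \<le> ide"
    using X(1)[OF xy(1)] X(1)[OF xy(2)]
    by (auto simp: finitely_measurable_atom_def subidentity_atom_def)
  have "x ;; a ;; y \<le> x ;; top ;; y"
    by (intro comp_mono) auto
  then obtain m where m: "atom m" "m \<le> x ;; a ;; y"
    using atom_below[OF X(1)[OF xy(1)] y xy(3)] by blast
  have "x ;; a ;; y \<le> ide ;; a ;; ide"
    using \<open>x \<le> ide\<close> \<open>y \<le> ide\<close> by (intro comp_mono) auto
  with m show "\<exists>m. atom m \<and> m \<le> a"
    by (auto simp: comp_ide ide_comp)
qed

end

theorem theorem8p3:
  fixes comp :: "'a::boolean_algebra \<Rightarrow> 'a \<Rightarrow> 'a"
    and conv :: "'a \<Rightarrow> 'a"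
    and ide :: "'a"
  assumes "relation_algebra comp conv ide"
    and "relation_algebra.finitely_measurable comp conv ide"
  shows "atomic_algebra TYPE('a)"
  using assms by (rule relation_algebra.atomic_of_finitely_measurable)

end
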